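(* Let $k$ be a positive integer and let $f_n:[0,+\infty)\to(0,+\infty)$, $n=0,1,2,\dots$, be continuous, bounded, positive functions with $f_{n+k}=f_n$ for all $n$. Assume that for every $n=1,2,\dots,k$ the function $x\mapsto f_n(x)$ is strictly decreasing on $[0,+\infty)$ and the function $x\mapsto x f_n(x)$ is strictly increasing on $[0,+\infty)$. If $$\prod_{n=1}^{k}f_n(0)>1\quad\text{and}\quad \lim_{x\to+\infty}\prod_{n=1}^{k}f_n(x)<1,$$ then there exists a $k$-periodic solution $x_n^*$ (that is, $x_n^*=x_{n+k}^*$) of $$x_{n+1}=x_nf_n(x_{n-1}),\quad n=0,1,2,\dots,$$ which is globally attractive, that is, for any solution $x_n$ of this equation, $$\lim_{n\to+\infty}(x_n-x_n^* )=0.$$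
   Context: A solution of $x_{n+1}=x_nf_n(x_{n-1})$, $n=0,1,2,\dots$, means a sequence $(x_n)_{n\ge -1}$ satisfying the equation with initial conditions $x_0=x^0>0$ and $x_{-1}=x^{-1}\ge 0$. *)

theory Defs imports "HOL-Analysis.Analysis" begin

text \<open>A solution is a sequence with indices \<open>n \<ge> -1\<close>. It is represented by a function
  on the integers whose values at indices below \<open>-1\<close> are irrelevant.\<close>

definition is_solution :: "(nat \<Rightarrow> real \<Rightarrow> real) \<Rightarrow> (int \<Rightarrow> real) \<Rightarrow> bool" where
  "is_solution f x \<longleftrightarrow> x 0 > 0 \<and> x (-1) \<ge> 0 \<and>
     (\<forall>n::nat. x (int n + 1) = x (int n) * f n (x (int n - 1)))"

text \<open>The number \<open>k\<close> is a period, not necessarily the least one.\<close>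

definition periodic_seq :: "nat \<Rightarrow> (int \<Rightarrow> real) \<Rightarrow> bool" where
  "periodic_seq k x \<longleftrightarrow> (\<forall>n\<ge>-1. x n = x (n + int k))"

definition globally_attractive :: "(nat \<Rightarrow> real \<Rightarrow> real) \<Rightarrow> (int \<Rightarrow> real) \<Rightarrow> bool" where
  "globally_attractive f y \<longleftrightarrow>
     (\<forall>x. is_solution f x \<longrightarrow> (\<lambda>n::nat. x (int n) - y (int n)) \<longlonglongrightarrow> 0)"

end

theory Submission imports Defs begin

text \<open>
  In the logarithms \<open>y n = ln (x n)\<close> the equation becomes
  \<open>y (n + 1) = y n + \<phi> n (y (n - 1))\<close> with \<open>\<phi> n t = ln (f n (exp t))\<close>. Monotonicity of
  \<open>f n\<close> and of \<open>x * f n x\<close> says precisely that \<open>\<phi> n\<close> is strictly decreasing and that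
  \<open>t + \<phi> n t\<close> is strictly increasing. Hence the difference \<open>z\<close> of two solutions satisfies
  \<open>z (n + 1) = z n - c n * z (n - 1)\<close> with coefficients \<open>0 < c n < 1\<close>.

  Each of the matrices of this recursion maps the hexagon with vertices \<open>(1, 1)\<close>, \<open>(1, 0)\<close>,
  \<open>(0, 1)\<close> and their negatives into itself. For \<open>c = 1\<close> the matrix permutes the vertices
  cyclically, for \<open>c = 0\<close> it is a projection onto the diagonal, and a general \<open>c\<close> is a
  convex combination of the two. So the norm \<open>hexnorm (u, v) = max \<bar>u\<bar> \<bar>v\<bar> \<bar>v - u\<bar>\<close>, whose
  unit ball is this hexagon, never increases along the difference of two solutions. As the
  coefficients avoid \<open>0\<close> and \<open>1\<close>, it strictly decreases within three steps unless the solutions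
  coincide (\<open>hexnorm_three_steps_less\<close>).

  The conditions on the products keep every solution in a bounded set: as long as \<open>y\<close> is large, it
  decreases over one period, and as long as it is very negative, it increases
  (\<open>delayed_feedback_bdd_above\<close>, used once directly and once for \<open>- y\<close>). By compactness the states
  of two solutions at multiples of \<open>k\<close> accumulate at some pair of states. The norm of the difference,
  being monotone, has the same value along the solutions started from this pair as its limit along
  the given ones, and the strict decrease forces that value to be \<open>0\<close>. Thus any two solutions are
  asymptotic to each other (\<open>orbits_asymptotic\<close>).

  In particular a solution is asymptotic to its own shift by one period, so an accumulation point of
  its states at multiples of \<open>k\<close> is a fixed point of the period map, that is, the initial state
  of a \<open>k\<close>-periodic solution. It attracts all the others, since all solutions are asymptotic.
\<close>

section \<open>The hexagonal norm\<close>

definition hexnorm :: "real \<times> real \<Rightarrow> real" where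
  "hexnorm p = max (max \<bar>fst p\<bar> \<bar>snd p\<bar>) \<bar>snd p - fst p\<bar>"

lemma hexnorm_nonneg: "hexnorm p \<ge> 0"
  by (simp add: hexnorm_def)

lemma hexnorm_eq_0_iff: "hexnorm p = 0 \<longleftrightarrow> p = 0"
  by (auto simp: hexnorm_def prod_eq_iff max_def split: if_splits)

lemma abs_fst_le_hexnorm: "\<bar>fst p\<bar> \<le> hexnorm p"
  by (simp add: hexnorm_def)

lemma tendsto_hexnorm:
  assumes "(g \<longlongrightarrow> p) F"
  shows "((\<lambda>x. hexnorm (g x)) \<longlongrightarrow> hexnorm p) F"
  unfolding hexnorm_def by (intro tendsto_intros assms)

text \<open>The relation says that \<open>w = - c * z\<close> for some \<open>c\<close> with \<open>0 < c < 1\<close>. Stated by signs it is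
  accessible to linear arithmetic.\<close>

definition damps :: "real \<Rightarrow> real \<Rightarrow> bool" where
  "damps z w \<longleftrightarrow> z = 0 \<and> w = 0 \<or> 0 < z \<and> - z < w \<and> w < 0 \<or> z < 0 \<and> 0 < w \<and> w < - z"

text \<open>The new entry \<open>v + w = v - c * u\<close> lies between \<open>v\<close> and \<open>v - u\<close>, both of which are
  already controlled by \<open>hexnorm (u, v)\<close>, and the new difference \<open>w\<close> is smaller than \<open>u\<close>.\<close>

lemma hexnorm_step_le:
  assumes "damps u w"
  shows "hexnorm (v, v + w) \<le> hexnorm (u, v)"
  using assms unfolding damps_def hexnorm_def by (auto simp: max_def abs_if)

lemma damps_abs_less:
  assumes "damps z w" "\<bar>z\<bar> \<le> N" "0 < N"
  shows "\<bar>w\<bar> < N"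
  using assms unfolding damps_def by auto

text \<open>A strict convex combination of \<open>v\<close> and \<open>v - u\<close> can have modulus \<open>N\<close> only if both
  points do. So strictness of the bound on the second point suffices.\<close>

lemma abs_damped_less:
  assumes "damps u w" "\<bar>v\<bar> \<le> N" "\<bar>v - u\<bar> < N"
  shows "\<bar>v + w\<bar> < N"
  using assms unfolding damps_def by (auto simp: abs_if split: if_splits)

text \<open>Every step makes the difference of consecutive entries strictly smaller than the initial norm
  \<open>N\<close>, and by \<open>abs_damped_less\<close> a small difference makes the entry that comes two places later
  strictly smaller than \<open>N\<close>. Both entries of the state have been replaced in this way
  after three steps. Two steps are not enough: \<open>(0, 1)\<close> is followed by \<open>(1, 1)\<close> and \<open>(1, 1 - c)\<close>,
  all of norm \<open>1\<close>.\<close>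

lemma hexnorm_three_steps_less:
  assumes "damps z0 w0" "damps z1 w1" "damps z2 w2"
    and "z2 = z1 + w0" "z3 = z2 + w1" "z4 = z3 + w2" and "(z0, z1) \<noteq> 0"
  shows "hexnorm (z3, z4) < hexnorm (z0, z1)"
proof -
  define N where "N = hexnorm (z0, z1)"
  have N: "N > 0"
    using assms(7) hexnorm_nonneg[of "(z0, z1)"] hexnorm_eq_0_iff[of "(z0, z1)"]
    unfolding N_def by linarith
  have H1: "hexnorm (z1, z2) \<le> N" and H2: "hexnorm (z2, z3) \<le> N"
    using hexnorm_step_le[OF assms(1), of z1] hexnorm_step_le[OF assms(2), of z2] assms(4,5)
    unfolding N_def by auto
  have z: "\<bar>z0\<bar> \<le> N" "\<bar>z1\<bar> \<le> N" "\<bar>z2\<bar> \<le> N" "\<bar>z3\<bar> \<le> N"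
    using H1 H2 by (auto simp: N_def hexnorm_def)
  have w: "\<bar>w0\<bar> < N" "\<bar>w1\<bar> < N" "\<bar>w2\<bar> < N"
    using assms(1-3) z N by (blast intro: damps_abs_less)+
  have "\<bar>z3\<bar> < N" "\<bar>z4\<bar> < N"
    using abs_damped_less[OF assms(2) z(3)] abs_damped_less[OF assms(3) z(4)] w assms(4-6) by auto
  then have "hexnorm (z3, z4) < N"
    using w(3) assms(6) by (simp add: hexnorm_def)
  then show ?thesis by (simp add: N_def)
qed

section \<open>Bounds for solutions\<close>

lemma sum_periodic_window:
  fixes g :: "nat \<Rightarrow> real"
  assumes "\<And>n. g (n + k) = g n"
  shows "sum g {m..<m + k} = sum g {..<k}"
proof (induction m)
  case 0
  show ?case by (simp add: lessThan_atLeast0)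
next
  case (Suc m)
  have "sum g {m..<m + k} + g (m + k) = g m + sum g {Suc m..<Suc m + k}"
    by (metis add_Suc le_add1 sum.atLeastLessThan_Suc sum.atLeast_Suc_lessThan less_Suc_eq_le)
  with Suc assms show ?case by simp
qed

text \<open>As the increments are bounded by \<open>C\<close>, a value \<open>y n\<close> far above \<open>b\<close> forces all values
  over the preceding period to lie above \<open>b\<close>. The increments over that period then add up to at most
  \<open>\<Sum>n<k. \<phi> n b\<close>, which is negative, so \<open>y n\<close> is smaller than \<open>y (n - k)\<close>. A new maximum
  can therefore never occur above a certain level.\<close>

lemma delayed_feedback_bdd_above:
  fixes \<phi> :: "nat \<Rightarrow> real \<Rightarrow> real" and y :: "nat \<Rightarrow> real"
  assumes rec: "\<And>n. y (n + 2) = y (n + 1) + \<phi> n (y n)"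
    and per: "\<And>n t. \<phi> (n + k) t = \<phi> n t"
    and anti: "\<And>n s t. s \<le> t \<Longrightarrow> \<phi> n t \<le> \<phi> n s"
    and growth: "\<And>n. \<phi> n (y n) \<le> C"
    and neg: "(\<Sum>n<k. \<phi> n b) < 0"
  shows "\<exists>B. \<forall>n. y n \<le> B"
proof -
  have C: "y (n + 1 + j) \<le> y (n + 1) + real j * \<bar>C\<bar>" for n j
  proof (induction j)
    case (Suc j)
    have "y (n + 1 + Suc j) = y (n + 1 + j) + \<phi> (n + j) (y (n + j))"
      using rec[of "n + j"] by simp
    also have "\<dots> \<le> y (n + 1) + real j * \<bar>C\<bar> + \<bar>C\<bar>"
      using Suc growth[of "n + j"] by linarith
    finally show ?case by (simp add: algebra_simps)
  qed simp
  have diff: "y (m + 1 + j) - y (m + 1) = (\<Sum>i=m..<m + j. \<phi> i (y i))" for m j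
  proof (induction j)
    case (Suc j)
    then show ?case using rec[of "m + j"] by simp
  qed simp
  (* Only the increments from y 1 on are given by the feedback, so the k + 1 values before y n
     must not include y 0. Up to index k + 1 the bound is the maximum of the values. *)
  define B where "B = max (Max (y ` {..k + 1})) (b + real (k + 1) * \<bar>C\<bar>)"
  have "y n \<le> B" for n
  proof (induction n rule: less_induct)
    case (less n)
    show ?case
    proof (cases "n \<le> k + 1")
      case True
      then have "y n \<le> Max (y ` {..k + 1})" by (intro Max_ge) auto
      then show ?thesis by (simp add: B_def)
    next
      case False
      define m where "m = n - k - 2"
      have n: "n = (m + 1) + 1 + k" using False by (simp add: m_def)
      show ?thesis
      proof (rule ccontr)
        assume "\<not> y n \<le> B"
        then have big: "y n > b + real (k + 1) * \<bar>C\<bar>" by (simp add: B_def)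
        have above: "b \<le> y i" if "i \<in> {m + 1..<m + 1 + k}" for i
        proof -
          define j where "j = n - i"
          have j: "n = (i - 1) + 1 + j" "i = i - 1 + 1" "j \<le> k + 1"
            using that n by (auto simp: j_def)
          have "y n \<le> y i + real j * \<bar>C\<bar>" using C[of "i - 1" j] j by simp
          moreover have "real j * \<bar>C\<bar> \<le> real (k + 1) * \<bar>C\<bar>"
            using j(3) by (intro mult_right_mono) auto
          ultimately show ?thesis using big by linarith
        qed
        have "y n - y (m + 1 + 1) = (\<Sum>i=m + 1..<m + 1 + k. \<phi> i (y i))"
          using diff[of "m + 1" k] n by simp
        also have "\<dots> \<le> (\<Sum>i=m + 1..<m + 1 + k. \<phi> i b)"
          by (intro sum_mono anti above)
        also have "\<dots> < 0"
          using sum_periodic_window[of "\<lambda>i. \<phi> i b" k "m + 1"] per neg by simp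
        finally have "y n < y (m + 1 + 1)" by simp
        moreover have "k > 0" using neg by (cases k) auto
        ultimately show False
          using less[of "m + 1 + 1"] n \<open>\<not> y n \<le> B\<close> by simp
      qed
    qed
  qed
  then show ?thesis by blast
qed

lemma periodic_bdd_below:
  fixes g :: "nat \<Rightarrow> real"
  assumes "\<And>n. g (n + k) = g n" "k > 0"
  shows "\<exists>c. \<forall>n. c \<le> g n"
proof -
  have "Min (g ` {..<k}) \<le> g n" for n
  proof (induction n rule: less_induct)
    case (less n)
    show ?case
    proof (cases "n < k")
      case False
      then show ?thesis using less[of "n - k"] assms(1)[of "n - k"] \<open>k > 0\<close> by simp
    qed (auto intro: Min_le)
  qed
  then show ?thesis by blast
qed

section \<open>Periodic equations with damped delayed feedback\<close>

text \<open>The state at time \<open>n\<close> is the pair of consecutive values \<open>y n\<close> and \<open>y (n + 1)\<close> of a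
  solution, indexed so that \<open>\<phi> n\<close> acts on its first entry. For the multiplicative equation the
  state at time \<open>0\<close> is thus the one at the indices \<open>-1\<close> and \<open>0\<close>.\<close>

primrec orbit :: "(nat \<Rightarrow> real \<Rightarrow> real) \<Rightarrow> real \<times> real \<Rightarrow> nat \<Rightarrow> real \<times> real" where
  "orbit \<phi> p 0 = p"
| "orbit \<phi> p (Suc n) = (snd (orbit \<phi> p n), snd (orbit \<phi> p n) + \<phi> n (fst (orbit \<phi> p n)))"

text \<open>Below the level \<open>a\<close> the feedback pushes a solution up over every full period, and above
  the level \<open>b\<close> it pushes the solution down.\<close>

locale damped_delay =
  fixes k :: nat and \<phi> :: "nat \<Rightarrow> real \<Rightarrow> real" and a b C :: real
  assumes k_pos: "k > 0"
    and periodic: "\<phi> (n + k) t = \<phi> n t"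
    and decreasing: "s < t \<Longrightarrow> \<phi> n t < \<phi> n s"
    and slope: "s < t \<Longrightarrow> s + \<phi> n s < t + \<phi> n t"
    and bdd: "\<phi> n t \<le> C"
    and sum_pos: "(\<Sum>n<k. \<phi> n a) > 0"
    and sum_neg: "(\<Sum>n<k. \<phi> n b) < 0"
begin

lemma damps_difference: "damps (s - t) (\<phi> n s - \<phi> n t)"
  using decreasing[of s t n] decreasing[of t s n] slope[of s t n] slope[of t s n]
  by (cases s t rule: linorder_cases) (auto simp: damps_def)

text \<open>The two monotonicity conditions together bound the slopes of \<open>\<phi> n\<close> by \<open>1\<close>.\<close>

lemma isCont_feedback: "isCont (\<phi> n) t"
proof -
  have "1-lipschitz_on UNIV (\<phi> n)"
  proof (rule lipschitz_onI)
    fix s t :: real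
    show "dist (\<phi> n s) (\<phi> n t) \<le> 1 * dist s t"
      using damps_difference[of s t n] by (auto simp: damps_def dist_real_def)
  qed simp
  then show ?thesis
    using lipschitz_on_continuous_on continuous_on_eq_continuous_at by blast
qed

lemma tendsto_orbit:
  assumes "(g \<longlongrightarrow> p) F"
  shows "((\<lambda>x. orbit \<phi> (g x) n) \<longlongrightarrow> orbit \<phi> p n) F"
proof (induction n)
  case (Suc n)
  then show ?case
    by (auto intro!: tendsto_intros isCont_tendsto_compose[OF isCont_feedback])
qed (simp add: assms)

lemma periodic_mult: "\<phi> (n + k * j) t = \<phi> n t"
proof (induction j)
  case (Suc j)
  then show ?case using periodic[of "n + k * j" t] by (simp add: ac_simps)
qed simp

lemma orbit_add_mult: "orbit \<phi> p (k * j + n) = orbit \<phi> (orbit \<phi> p (k * j)) n"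
  using periodic_mult by (induction n) (simp_all add: add.commute)

lemma orbit_difference_Suc:
  "orbit \<phi> p (Suc n) - orbit \<phi> q (Suc n) =
     (snd (orbit \<phi> p n - orbit \<phi> q n), snd (orbit \<phi> p n - orbit \<phi> q n) +
        (\<phi> n (fst (orbit \<phi> p n)) - \<phi> n (fst (orbit \<phi> q n))))"
  by (simp add: prod_eq_iff)

lemma hexnorm_orbits_decseq: "decseq (\<lambda>n. hexnorm (orbit \<phi> p n - orbit \<phi> q n))"
proof (rule decseq_SucI)
  fix n
  show "hexnorm (orbit \<phi> p (Suc n) - orbit \<phi> q (Suc n)) \<le> hexnorm (orbit \<phi> p n - orbit \<phi> q n)"
    unfolding orbit_difference_Suc
    using damps_difference[of "fst (orbit \<phi> p n)" "fst (orbit \<phi> q n)" n, THEN hexnorm_step_le]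
    by (metis fst_diff prod.collapse)
qed

lemma hexnorm_orbits_less:
  assumes "p \<noteq> q"
  shows "hexnorm (orbit \<phi> p 3 - orbit \<phi> q 3) < hexnorm (p - q)"
proof -
  define y where "y r n = fst (orbit \<phi> r n)" for r n
  define z where "z n = y p n - y q n" for n
  have pair: "orbit \<phi> p n - orbit \<phi> q n = (z n, z (Suc n))" for n
    by (simp add: prod_eq_iff z_def y_def)
  have rec: "z (Suc (Suc n)) = z (Suc n) + (\<phi> n (y p n) - \<phi> n (y q n))" for n
    by (simp add: z_def y_def)
  have damps: "damps (z n) (\<phi> n (y p n) - \<phi> n (y q n))" for n
    unfolding z_def by (rule damps_difference)
  have "(z 0, z (Suc 0)) \<noteq> 0" using pair[of 0] assms by auto
  then have "hexnorm (z (Suc (Suc (Suc 0))), z (Suc (Suc (Suc (Suc 0)))))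
      < hexnorm (z 0, z (Suc 0))"
    by (rule hexnorm_three_steps_less[OF damps damps damps rec rec rec])
  then show ?thesis using pair[of 0] pair[of 3] by (simp add: numeral_3_eq_3)
qed

text \<open>The lower bound is the upper bound for \<open>- y\<close>, which solves the equation with feedback
  \<open>- \<phi> n (- t)\<close>. Its increments are bounded because \<open>y\<close> is already bounded above.\<close>

lemma bounded_orbit: "bounded (range (orbit \<phi> p))"
proof -
  define y where "y n = fst (orbit \<phi> p n)" for n
  have rec: "y (n + 2) = y (n + 1) + \<phi> n (y n)" for n by (simp add: y_def)
  have anti: "s \<le> t \<Longrightarrow> \<phi> n t \<le> \<phi> n s" for n s t
    using decreasing[of s t n] by (cases "s = t") auto
  obtain B where B: "\<And>n. y n \<le> B"
    using delayed_feedback_bdd_above[of y \<phi> k C b] rec periodic anti bdd sum_neg by blast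
  obtain c where c: "\<And>n. c \<le> \<phi> n B"
    using periodic_bdd_below[of "\<lambda>n. \<phi> n B" k] periodic k_pos by blast
  have "\<exists>A. \<forall>n. - y n \<le> A"
  proof (rule delayed_feedback_bdd_above[of _ "\<lambda>n t. - \<phi> n (- t)" k "- c" "- a"])
    show "- \<phi> n (- (- y n)) \<le> - c" for n using c[of n] anti[OF B[of n], of n] by simp
  qed (use rec periodic anti sum_pos in \<open>auto simp: sum_negf\<close>)
  then obtain A where A: "\<And>n. - y n \<le> A" by blast
  have y: "\<bar>y n\<bar> \<le> \<bar>A\<bar> + \<bar>B\<bar>" for n using A[of n] B[of n] by linarith
  have "orbit \<phi> p n = (y n, y (Suc n))" for n by (simp add: y_def prod_eq_iff)
  moreover have "norm (y n, y (Suc n)) \<le> 2 * (\<bar>A\<bar> + \<bar>B\<bar>)" for n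
    using norm_Pair_le[of "y n" "y (Suc n)"] y[of n] y[of "Suc n"] by simp
  ultimately show ?thesis by (auto simp: bounded_iff)
qed

text \<open>At an accumulation point \<open>(u, v)\<close> of the pairs of states at multiples of the period the
  monotone quantity \<open>d\<close> has settled: started from \<open>u\<close> and \<open>v\<close>, it stays constant. This
  contradicts strict decrease unless \<open>u = v\<close>. The argument replaces a uniform contraction rate, which
  need not exist.\<close>

lemma orbits_asymptotic: "(\<lambda>n. hexnorm (orbit \<phi> p n - orbit \<phi> q n)) \<longlonglongrightarrow> 0"
proof -
  define d where "d n = hexnorm (orbit \<phi> p n - orbit \<phi> q n)" for n
  obtain c where c: "d \<longlonglongrightarrow> c"
    using decseq_convergent[of d 0] hexnorm_orbits_decseq[of p q] hexnorm_nonneg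
    unfolding d_def by blast
  define X where "X j = (orbit \<phi> p (k * j), orbit \<phi> q (k * j))" for j
  have "range X \<subseteq> range (orbit \<phi> p) \<times> range (orbit \<phi> q)" by (auto simp: X_def)
  then have "bounded (range X)"
    using bounded_Times[OF bounded_orbit bounded_orbit] bounded_subset by blast
  then obtain l r where r: "strict_mono r" "(X \<circ> r) \<longlonglongrightarrow> l"
    using bounded_imp_convergent_subsequence by blast
  obtain u v where l: "l = (u, v)" by (cases l)
  have u: "(\<lambda>j. orbit \<phi> p (k * r j)) \<longlonglongrightarrow> u" and v: "(\<lambda>j. orbit \<phi> q (k * r j)) \<longlonglongrightarrow> v"
    using tendsto_fst[OF r(2)] tendsto_snd[OF r(2)] by (simp_all add: X_def l o_def)
  have lim: "hexnorm (orbit \<phi> u i - orbit \<phi> v i) = c" for i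
  proof (rule LIMSEQ_unique)
    have "(\<lambda>j. hexnorm (orbit \<phi> (orbit \<phi> p (k * r j)) i - orbit \<phi> (orbit \<phi> q (k * r j)) i))
            \<longlonglongrightarrow> hexnorm (orbit \<phi> u i - orbit \<phi> v i)"
      by (intro tendsto_hexnorm tendsto_diff tendsto_orbit u v)
    then show "(\<lambda>j. d (k * r j + i)) \<longlonglongrightarrow> hexnorm (orbit \<phi> u i - orbit \<phi> v i)"
      by (simp add: d_def orbit_add_mult)
    have "strict_mono (\<lambda>j. k * r j + i)"
      using r(1) k_pos by (auto simp: strict_mono_def)
    from LIMSEQ_subseq_LIMSEQ[OF c this] show "(\<lambda>j. d (k * r j + i)) \<longlonglongrightarrow> c"
      by (simp add: o_def)
  qed
  have "u = v" using hexnorm_orbits_less[of u v] lim[of 0] lim[of 3] by fastforce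
  then have "c = 0" using lim[of 0] hexnorm_eq_0_iff[of 0] by simp
  with c show ?thesis by (simp add: d_def[abs_def])
qed

text \<open>A solution and its shift by one period are asymptotic. In the limit along states
  \<open>x (k * r j)\<close> converging to \<open>p\<close> this says that the period map fixes \<open>p\<close>.\<close>

lemma periodic_orbit_exists: "\<exists>p. \<forall>n. orbit \<phi> p (n + k) = orbit \<phi> p n"
proof -
  define x where "x = orbit \<phi> 0"
  have "bounded (range (\<lambda>j. x (k * j)))"
    using bounded_orbit[of 0] by (rule bounded_subset) (auto simp: x_def)
  then obtain p r where r: "strict_mono r" "((\<lambda>j. x (k * j)) \<circ> r) \<longlonglongrightarrow> p"
    using bounded_imp_convergent_subsequence by blast
  then have p: "(\<lambda>j. x (k * r j)) \<longlonglongrightarrow> p" by (simp add: o_def)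
  have shift: "orbit \<phi> (orbit \<phi> 0 k) (k * j) = orbit \<phi> (x (k * j)) k" for j
    using orbit_add_mult[of 0 1 "k * j"] orbit_add_mult[of 0 j k]
    by (simp add: x_def add.commute)
  have "hexnorm (p - orbit \<phi> p k) = 0"
  proof (rule LIMSEQ_unique)
    show "(\<lambda>j. hexnorm (x (k * r j) - orbit \<phi> (x (k * r j)) k)) \<longlonglongrightarrow> hexnorm (p - orbit \<phi> p k)"
      by (intro tendsto_hexnorm tendsto_diff tendsto_orbit p)
    have "strict_mono (\<lambda>j. k * r j)" using r(1) k_pos by (auto simp: strict_mono_def)
    from LIMSEQ_subseq_LIMSEQ[OF orbits_asymptotic[of 0 "orbit \<phi> 0 k"] this]
    show "(\<lambda>j. hexnorm (x (k * r j) - orbit \<phi> (x (k * r j)) k)) \<longlonglongrightarrow> 0"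
      by (simp add: o_def shift x_def)
  qed
  then have "orbit \<phi> p k = p" by (simp add: hexnorm_eq_0_iff)
  then show ?thesis
    using orbit_add_mult[of p 1] by (metis add.commute mult.right_neutral)
qed

lemma orbit_unique:
  assumes "\<And>n. y (n + 2) = y (n + 1) + \<phi> n (y n)"
  shows "orbit \<phi> (y 0, y 1) n = (y n, y (n + 1))"
  using assms by (induction n) auto

end

section \<open>Transfer to the multiplicative equation\<close>

lemma is_solution_pos:
  assumes "is_solution f x" "\<And>n t. t \<ge> 0 \<Longrightarrow> f n t > 0"
  shows "x (int n) > 0"
proof -
  have "x (int n) > 0 \<and> x (int n - 1) \<ge> 0"
  proof (induction n)
    case 0
    then show ?case using assms(1) by (simp add: is_solution_def)
  next
    case (Suc n)
    have "x (int n + 1) = x (int n) * f n (x (int n - 1))"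
      using assms(1) by (simp add: is_solution_def)
    with Suc assms(2)[of "x (int n - 1)" n] show ?case by (simp add: add.commute)
  qed
  then show ?thesis ..
qed

theorem theorem1p1:
  fixes k :: nat and f :: "nat \<Rightarrow> real \<Rightarrow> real" and L :: real
  assumes "k > 0"
    and "\<And>n. continuous_on {0..} (f n)"
    and "\<And>n. bounded (f n ` {0..})"
    and "\<And>n x. x \<ge> 0 \<Longrightarrow> f n x > 0"
    and "\<And>n x. x \<ge> 0 \<Longrightarrow> f (n + k) x = f n x"
    and "\<And>n. n \<in> {1..k} \<Longrightarrow> strict_antimono_on {0..} (f n)"
    and "\<And>n. n \<in> {1..k} \<Longrightarrow> strict_mono_on {0..} (\<lambda>x. x * f n x)"
    and "(\<Prod>n=1..k. f n 0) > 1"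
    and "((\<lambda>x. \<Prod>n=1..k. f n x) \<longlongrightarrow> L) at_top"
    and "L < 1"
  shows "\<exists>y. is_solution f y \<and> periodic_seq k y \<and> globally_attractive f y"
proof -
  define \<phi> where "\<phi> n t = ln (f n (exp t))" for n t
  note pos = assms(4)
  have \<phi>_per: "\<phi> (n + k) t = \<phi> n t" for n t by (simp add: \<phi>_def assms(5))
  have rep: "\<exists>m\<in>{1..k}. \<forall>x\<ge>0. f n x = f m x" for n
  proof (induction n rule: less_induct)
    case (less n)
    consider "n = 0" | "n \<in> {1..k}" | "n > k" by fastforce
    then show ?case
    proof cases
      case 1
      then show ?thesis using assms(1) assms(5)[of _ 0] by (intro bexI[of _ k]) auto
    next
      case 3
      then show ?thesis using less[of "n - k"] assms(1) assms(5)[of _ "n - k"] by auto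
    qed auto
  qed
  have anti: "f n t < f n s" if "0 \<le> s" "s < t" for n s t
    using rep[of n] assms(6) that by (fastforce simp: monotone_on_def)
  have mono: "s * f n s < t * f n t" if "0 \<le> s" "s < t" for n s t
    using rep[of n] assms(7) that by (fastforce simp: monotone_on_def)
  have sum_\<phi>: "(\<Sum>n<k. \<phi> n (ln t)) = ln (\<Prod>n=1..k. f n t)" if "t > 0" for t
  proof -
    have "(\<Sum>n<k. \<phi> n (ln t)) = (\<Sum>n=1..k. \<phi> n (ln t))"
      using sum_periodic_window[of "\<lambda>n. \<phi> n (ln t)" k 1] \<phi>_per
      by (simp add: atLeastLessThanSuc_atLeastAtMost)
    also have "\<dots> = ln (\<Prod>n=1..k. f n t)"
      using that pos[of t] by (simp add: \<phi>_def ln_prod order_less_imp_not_eq2)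
    finally show ?thesis .
  qed
  have prod_pos: "(\<Prod>n=1..k. f n t) > 0" if "t \<ge> 0" for t
    using pos[OF that] by (intro prod_pos) auto
  have "eventually (\<lambda>t. (\<Prod>n=1..k. f n t) > 1) (at 0 within {0..})"
  proof (rule order_tendstoD(1)[OF _ assms(8)])
    show "((\<lambda>t. \<Prod>n=1..k. f n t) \<longlongrightarrow> (\<Prod>n=1..k. f n 0)) (at 0 within {0..})"
      using assms(2) by (intro tendsto_prod) (simp add: continuous_on_def)
  qed
  then have "eventually (\<lambda>t. (\<Prod>n=1..k. f n t) > 1) (at_right (0::real))"
    by (rule filter_leD[OF at_le, rotated]) auto
  then have "eventually (\<lambda>t. (\<Prod>n=1..k. f n t) > 1 \<and> t > 0) (at_right (0::real))"
    using eventually_at_right_less by eventually_elim auto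
  then obtain a where a: "a > 0" "(\<Prod>n=1..k. f n a) > 1"
    using eventually_happens'[OF trivial_limit_at_right_real] by blast
  have "eventually (\<lambda>t. (\<Prod>n=1..k. f n t) < 1 \<and> t > 0) at_top"
    using order_tendstoD(2)[OF assms(9,10)] eventually_gt_at_top[of 0] by eventually_elim auto
  then obtain b where b: "b > 0" "(\<Prod>n=1..k. f n b) < 1"
    using eventually_happens'[OF trivial_limit_at_top_linorder] by blast
  (* Since f n is decreasing, f n 0 bounds it, and periodicity makes the bound uniform in n. *)
  obtain c where c: "\<And>n. c \<le> - ln (f n 0)"
    using periodic_bdd_below[of "\<lambda>n. - ln (f n 0)" k] assms(1) assms(5)[OF order_refl] by metis
  interpret damped_delay k \<phi> "ln a" "ln b" "- c"
  proof
    fix n and s t :: real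
    show "\<phi> n t \<le> - c"
    proof -
      have "ln (f n (exp t)) \<le> ln (f n 0)"
        using anti[of 0 "exp t" n] pos[of "exp t" n] by simp
      then show ?thesis using c[of n] by (simp add: \<phi>_def)
    qed
  next
    fix n and s t :: real
    assume st: "s < t"
    show "\<phi> n t < \<phi> n s" using anti[of "exp s" "exp t" n] st pos by (simp add: \<phi>_def)
    have "ln (exp s * f n (exp s)) < ln (exp t * f n (exp t))"
      using mono[of "exp s" "exp t" n] st pos by simp
    then show "s + \<phi> n s < t + \<phi> n t"
      using pos[of "exp s" n] pos[of "exp t" n] by (simp add: \<phi>_def ln_mult)
  next
    show "(\<Sum>n<k. \<phi> n (ln a)) > 0" "(\<Sum>n<k. \<phi> n (ln b)) < 0"
      using a b prod_pos[of b] by (simp_all add: sum_\<phi> ln_less_zero)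
  qed (use assms(1) \<phi>_per in auto)

  obtain p where p: "\<And>n. orbit \<phi> p (n + k) = orbit \<phi> p n"
    using periodic_orbit_exists by blast
  define v where "v n = fst (orbit \<phi> p n)" for n
  define y where "y i = exp (v (nat (i + 1)))" for i
  have v_rec: "v (n + 2) = v (n + 1) + \<phi> n (v n)" for n by (simp add: v_def)
  have v_per: "v (n + k) = v n" for n by (simp add: v_def p)
  have "is_solution f y"
    unfolding is_solution_def
  proof (intro conjI allI)
    fix n :: nat
    have "nat (int n + 1 + 1) = n + 2" "nat (int n + 1) = n + 1" "nat (int n - 1 + 1) = n" by auto
    then show "y (int n + 1) = y (int n) * f n (y (int n - 1))"
      using v_rec[of n] pos[of "exp (v n)" n] by (simp add: y_def \<phi>_def exp_add)
  qed (auto simp: y_def)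
  moreover have "periodic_seq k y"
    unfolding periodic_seq_def
  proof (intro allI impI)
    fix n :: int
    assume "-1 \<le> n"
    then have "nat (n + int k + 1) = nat (n + 1) + k" by simp
    then show "y n = y (n + int k)" by (simp add: y_def v_per)
  qed
  moreover have "globally_attractive f y"
    unfolding globally_attractive_def
  proof (intro allI impI)
    fix x
    assume x: "is_solution f x"
    (* As x (-1) may be 0, logarithms are taken only from index k - 1 on, one full period after
       index -1, where the coefficients repeat. *)
    define m where "m = k - 1"
    have k: "k = Suc m" using assms(1) by (simp add: m_def)
    define u where "u n = ln (x (int (n + m)))" for n
    have xpos: "x (int n) > 0" for n using is_solution_pos[OF x pos] .
    have x_exp: "x (int (n + m)) = exp (u n)" for n using xpos[of "n + m"] by (simp add: u_def)
    have "u (n + 2) = u (n + 1) + \<phi> n (u n)" for n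
    proof -
      have "x (int (n + k) + 1) = x (int (n + k)) * f (n + k) (x (int (n + k) - 1))"
        using x unfolding is_solution_def by blast
      moreover have "int (n + k) + 1 = int (n + 2 + m)" "int (n + k) = int (n + 1 + m)"
        "int (n + k) - 1 = int (n + m)" by (auto simp: k)
      ultimately have "exp (u (n + 2)) = exp (u (n + 1)) * f n (exp (u n))"
        using assms(5)[of "exp (u n)" n] by (metis x_exp exp_ge_zero)
      also have "\<dots> = exp (u (n + 1) + \<phi> n (u n))"
        using pos[of "exp (u n)" n] by (simp add: \<phi>_def exp_add)
      finally show ?thesis by simp
    qed
    from orbit_unique[OF this] have u: "fst (orbit \<phi> (u 0, u 1) n) = u n" for n by simp
    have "(\<lambda>n. u n - v n) \<longlonglongrightarrow> 0"
    proof (rule Lim_null_comparison[OF always_eventually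
          orbits_asymptotic[of "(u 0, u 1)" p]], rule allI)
      fix n
      show "norm (u n - v n) \<le> hexnorm (orbit \<phi> (u 0, u 1) n - orbit \<phi> p n)"
        using abs_fst_le_hexnorm[of "orbit \<phi> (u 0, u 1) n - orbit \<phi> p n"] u[of n]
        by (simp add: v_def)
    qed
    then have "(\<lambda>n. exp (u n - v n) - 1) \<longlonglongrightarrow> exp 0 - 1"
      by (intro tendsto_intros)
    then have null: "(\<lambda>n. exp (u n - v n) - 1) \<longlonglongrightarrow> 0" by simp
    obtain B where B: "\<And>n. norm (orbit \<phi> p n) \<le> B"
      using bounded_orbit[of p] by (auto simp: bounded_iff)
    have "norm (exp (v n)) \<le> exp B" for n
      using B[of n] norm_fst_le[of "fst (orbit \<phi> p n)" "snd (orbit \<phi> p n)"] by (simp add: v_def)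
    then have "(\<lambda>n. exp (v n) * (exp (u n - v n) - 1)) \<longlonglongrightarrow> 0"
      by (intro lim_null_mult_left_bounded[OF _ null] always_eventually) auto
    moreover have "exp (v n) * (exp (u n - v n) - 1) = x (int (n + m)) - y (int (n + m))" for n
    proof -
      have "nat (int (n + m) + 1) = n + k" by (simp add: k)
      then have "y (int (n + m)) = exp (v n)" by (simp add: y_def v_per)
      then show ?thesis unfolding x_exp by (simp add: exp_diff right_diff_distrib)
    qed
    ultimately have "(\<lambda>n. x (int (n + m)) - y (int (n + m))) \<longlonglongrightarrow> 0" by simp
    then show "(\<lambda>n. x (int n) - y (int n)) \<longlonglongrightarrow> 0"
      by (rule LIMSEQ_offset)
  qed
  ultimately show ?thesis by blast
qed

end
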